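(* Let $q$ be a prime power, let $b>0$ be a constant, and let $r$ be a real number with $0\le r\le \min\{1,b^{-1}\}$. Let $m=m(n)$ be a sequence of positive integers such that $\lim_{n\to\infty} \frac{n}{m}=b$, and let $\rho=\lfloor rn\rfloor$. Then $$k(r) := \liminf_{n\to\infty}\left[\log_{q^{mn}} K_R(q^m,n,\rho)\right] = (1-r)(1-br).$$
   Context: For $\mathbf{x}\in \mathrm{GF}(q^m)^n$, the rank weight $\mathrm{rk}(\mathbf{x})$ is the maximum number of coordinates of $\mathbf{x}$ that are linearly independent over $\mathrm{GF}(q)$; the rank distance is $d_R(\mathbf{x},\mathbf{y})=\mathrm{rk}(\mathbf{x}-\mathbf{y})$. The rank covering radius of a nonempty code $C\subseteq \mathrm{GF}(q^m)^n$ is $\max_{\mathbf{x}\in \mathrm{GF}(q^m)^n}\min_{\mathbf{c}\in C} d_R(\mathbf{x},\mathbf{c})$. $K_R(q^m,n,\rho)$ denotes the minimum number of balls of rank radius $\rho$ needed to cover $\mathrm{GF}(q^m)^n$, i.e. the minimum cardinality of a (not necessarily linear) code $C\subseteq\mathrm{GF}(q^m)^n$ with rank covering radius at most $\rho$ (in particular it equals $1$ if $\rho\ge\min\{m,n\}$). *)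

theory Defs
  imports
    Complex_Main
    "HOL-Library.Extended_Real"
    "HOL-Number_Theory.Prime_Powers"
    "HOL-Algebra.Embedded_Algebras"
begin

definition vectors :: "('a, 'b) ring_scheme \<Rightarrow> nat \<Rightarrow> 'a list set" where
  "vectors R n = {xs. set xs \<subseteq> carrier R \<and> length xs = n}"

definition vector_diff :: "('a, 'b) ring_scheme \<Rightarrow> 'a list \<Rightarrow> 'a list \<Rightarrow> 'a list" where
  "vector_diff R xs ys = map2 (\<lambda>x y. x \<ominus>\<^bsub>R\<^esub> y) xs ys"

text \<open>
  The parameter \<open>F\<close> is the subfield of scalars of \<open>R\<close>. The list \<open>nths xs I\<close> selects the coordinates
  of \<open>xs\<close> with position in \<open>I\<close>; a value that occurs at two selected positions occurs twice
  in the list, so the list is then not independent.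
\<close>

definition rank_weight :: "('a, 'b) ring_scheme \<Rightarrow> 'a set \<Rightarrow> 'a list \<Rightarrow> nat" where
  "rank_weight R F xs =
     Max {card I | I. I \<subseteq> {..<length xs} \<and> ring.independent R F (nths xs I)}"

definition rank_dist :: "('a, 'b) ring_scheme \<Rightarrow> 'a set \<Rightarrow> 'a list \<Rightarrow> 'a list \<Rightarrow> nat" where
  "rank_dist R F xs ys = rank_weight R F (vector_diff R xs ys)"

text \<open>
  \<open>Max\<close>, \<open>Min\<close> and \<open>LEAST\<close> below are meaningful for a finite field \<open>R\<close> and a nonempty
  code \<open>C\<close> contained in \<open>vectors R n\<close>.
\<close>

definition rank_covering_radius ::
  "('a, 'b) ring_scheme \<Rightarrow> 'a set \<Rightarrow> nat \<Rightarrow> 'a list set \<Rightarrow> nat" where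
  "rank_covering_radius R F n C =
     Max ((\<lambda>x. Min ((\<lambda>c. rank_dist R F x c) ` C)) ` vectors R n)"

definition min_rank_covering ::
  "('a, 'b) ring_scheme \<Rightarrow> 'a set \<Rightarrow> nat \<Rightarrow> nat \<Rightarrow> nat" where
  "min_rank_covering R F n \<rho> =
     (LEAST k. \<exists>C. C \<subseteq> vectors R n \<and> C \<noteq> {} \<and> rank_covering_radius R F n C \<le> \<rho> \<and> card C = k)"

end

theory Submission
  imports Defs
begin

text \<open>
  Up to factors \<open>2\<^sup>n\<close> and \<open>2\<^sup>m\<close>, whose logarithms are \<open>o(mn)\<close>, the minimum cardinality of a
  covering is \<open>q\<close> to the power \<open>(m - \<rho>)(n - \<rho>)\<close>. The lower bound is sphere covering: a ball of
  radius \<open>\<rho>\<close> has at most \<open>2\<^sup>n\<close> times \<open>q\<close> to the power \<open>m\<rho> + \<rho>(n - \<rho>)\<close> elements. For the upper bound,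
  fix a basis of the extension and take all vectors that vanish at some \<open>\<rho>\<close> positions and have
  their entries in the span of some \<open>m - \<rho>\<close> basis elements.
\<close>

section \<open>Counting lists with a prescribed set for each position\<close>

text \<open>A finite Cartesian product whose factor may depend on the position, encoded by lists to
  match \<open>vectors\<close>. The whole space, the pieces that cover a ball and the pieces of the
  covering code are all of this form.\<close>

definition list_box :: "nat \<Rightarrow> (nat \<Rightarrow> 'a set) \<Rightarrow> 'a list set" where
  "list_box n A = {xs. length xs = n \<and> (\<forall>i<n. xs ! i \<in> A i)}"

lemma list_box_0 [simp]: "list_box 0 A = {[]}"
  by (auto simp: list_box_def)

lemma list_box_Suc:
  "list_box (Suc n) A = (\<lambda>(x, xs). x # xs) ` (A 0 \<times> list_box n (A \<circ> Suc))"
proof (rule Set.set_eqI)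
  fix ys
  show "ys \<in> list_box (Suc n) A \<longleftrightarrow> ys \<in> (\<lambda>(x, xs). x # xs) ` (A 0 \<times> list_box n (A \<circ> Suc))"
    by (cases ys) (auto simp: list_box_def image_iff All_less_Suc2)
qed

lemma card_list_box: "card (list_box n A) = (\<Prod>i<n. card (A i))"
proof (induction n arbitrary: A)
  case (Suc n)
  have "card (list_box (Suc n) A) = card (A 0 \<times> list_box n (A \<circ> Suc))"
    unfolding list_box_Suc by (rule card_image) (auto simp: inj_on_def)
  then show ?case
    using Suc.IH[of "A \<circ> Suc"] by (simp add: prod.lessThan_Suc_shift card_cartesian_product del: prod.lessThan_Suc)
qed simp

lemma finite_list_box: "(\<And>i. i < n \<Longrightarrow> finite (A i)) \<Longrightarrow> finite (list_box n A)"
proof (induction n arbitrary: A)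
  case (Suc n)
  then have "finite (list_box n (A \<circ> Suc))" by simp
  with Suc.prems show ?case unfolding list_box_Suc by simp
qed simp

text \<open>Evaluates \<open>card_list_box\<close> when the factors have one size on
  \<open>I\<close> and another off \<open>I\<close>, the only shape that occurs later.\<close>

lemma prod_if_subset:
  fixes a b :: nat
  assumes "I \<subseteq> {..<n}"
  shows "(\<Prod>i<n. if i \<in> I then a else b) = a ^ card I * b ^ (n - card I)"
proof -
  have "{..<n} \<inter> {i. i \<in> I} = I" "{..<n} \<inter> - {i. i \<in> I} = {..<n} - I"
    using assms by auto
  moreover have "card ({..<n} - I) = n - card I"
    using assms by (simp add: card_Diff_subset finite_subset)
  ultimately show ?thesis by (simp add: prod.If_cases)
qed

lemma card_UN_le_mult:
  assumes "finite A" "\<And>x. x \<in> A \<Longrightarrow> card (f x) \<le> k"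
  shows "card (\<Union>x\<in>A. f x) \<le> card A * k"
  using order_trans[OF card_UN_le[OF assms(1)] sum_bounded_above[of A "\<lambda>x. card (f x)" k]] assms(2)
  by simp

section \<open>Selected coordinates and differences of vectors\<close>

lemma nths_cong:
  "length xs = length ys \<Longrightarrow> (\<And>i. i \<in> I \<Longrightarrow> i < length xs \<Longrightarrow> xs ! i = ys ! i) \<Longrightarrow> nths xs I = nths ys I"
proof (induction xs ys arbitrary: I rule: list_induct2)
  case (Cons x xs y ys)
  have "nths xs {j. Suc j \<in> I} = nths ys {j. Suc j \<in> I}"
    using Cons.prems[of "Suc _"] by (intro Cons.IH) auto
  then show ?case using Cons.prems[of 0] by (simp add: nths_Cons)
qed simp

lemma length_nths_subset: "I \<subseteq> {..<length xs} \<Longrightarrow> length (nths xs I) = card I"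
  unfolding length_nths by (rule arg_cong[where f = card]) auto

lemma vectors_nth: "xs \<in> vectors R n \<Longrightarrow> i < n \<Longrightarrow> xs ! i \<in> carrier R"
  unfolding vectors_def using nth_mem by fastforce

lemma vectors_eq_list_box: "vectors R n = list_box n (\<lambda>_. carrier R)"
  by (auto simp: vectors_def list_box_def subset_iff) (metis in_set_conv_nth)

lemma length_vector_diff [simp]: "length xs = length ys \<Longrightarrow> length (vector_diff R xs ys) = length xs"
  by (simp add: vector_diff_def)

lemma nth_vector_diff:
  "length xs = length ys \<Longrightarrow> i < length xs \<Longrightarrow> vector_diff R xs ys ! i = xs ! i \<ominus>\<^bsub>R\<^esub> ys ! i"
  by (simp add: vector_diff_def)

section \<open>Rank weight and independent coordinates\<close>

lemma (in ring) finite_independent_sets: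
  "finite {card I | I. I \<subseteq> {..<length xs} \<and> independent K (nths xs I)}"
proof -
  have "{card I | I. I \<subseteq> {..<length xs} \<and> independent K (nths xs I)} \<subseteq> card ` Pow {..<length xs}"
    by auto
  then show ?thesis by (rule finite_subset) simp
qed

lemma (in ring) rank_weight_ge:
  "I \<subseteq> {..<length xs} \<Longrightarrow> independent K (nths xs I) \<Longrightarrow> card I \<le> rank_weight R K xs"
  unfolding rank_weight_def by (rule Max_ge[OF finite_independent_sets]) auto

lemma (in ring) rank_weight_attained:
  obtains I where "I \<subseteq> {..<length xs}" "independent K (nths xs I)" "card I = rank_weight R K xs"
proof -
  have "{card I | I. I \<subseteq> {..<length xs} \<and> independent K (nths xs I)} \<noteq> {}"
    by (auto intro!: exI[of _ "{}"])
  from Max_in[OF finite_independent_sets this] that show ?thesis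
    unfolding rank_weight_def by auto
qed

text \<open>Coordinates that attain the rank form an independent list inside the span of
  \<open>Us\<close>, so there are at most \<open>length Us\<close> of them. This bounds the distance
  to a codeword once all entries of the difference lie in a small span.\<close>

lemma (in ring) rank_weight_le_length:
  assumes "subfield K R" "independent K Us" "set xs \<subseteq> Span K Us"
  shows "rank_weight R K xs \<le> length Us"
proof -
  obtain I where I: "I \<subseteq> {..<length xs}" "independent K (nths xs I)" "card I = rank_weight R K xs"
    by (rule rank_weight_attained)
  then have "length (nths xs I) \<le> length Us"
    using assms set_nths_subset[of xs I] by (intro independent_length_le[of K]) auto
  with I show ?thesis by (simp add: length_nths_subset)
qed

text \<open>An independent list is built from its end, each new head lying outside the span of the
  tail. Dropping entries only shrinks that span, so the remaining heads stay outside.\<close>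

lemma (in ring) independent_nths_mono:
  assumes "subfield K R"
  shows "independent K (nths xs I) \<Longrightarrow> I' \<subseteq> I \<Longrightarrow> independent K (nths xs I')"
proof (induction xs arbitrary: I I')
  case (Cons x xs)
  let ?J = "{j. Suc j \<in> I}" and ?J' = "{j. Suc j \<in> I'}"
  have sub: "?J' \<subseteq> ?J" using Cons.prems by auto
  have ind: "independent K (nths xs ?J)"
    using Cons.prems(1) by (auto simp: nths_Cons split: if_splits dest: independent_backwards)
  have car: "set (nths xs ?J) \<subseteq> carrier R" by (rule independent_in_carrier[OF ind])
  have ind': "independent K (nths xs ?J')" by (rule Cons.IH[OF ind sub])
  have "set (nths xs ?J') \<subseteq> set (nths xs ?J)" using sub by (auto simp: set_nths)
  then have span: "Span K (nths xs ?J') \<subseteq> Span K (nths xs ?J)"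
    by (rule mono_Span_sublist[OF assms _ car])
  show ?case
  proof (cases "0 \<in> I'")
    case True
    then have "independent K (x # nths xs ?J)"
      using Cons.prems by (auto simp: nths_Cons)
    then have "x \<in> carrier R" "x \<notin> Span K (nths xs ?J)" by (auto dest: independent_backwards)
    with True ind' span show ?thesis by (auto simp: nths_Cons simp del: Span.simps intro!: li_Cons)
  qed (use ind' in \<open>simp add: nths_Cons\<close>)
qed simp

text \<open>Greedy choice from the end of the list: a head is selected exactly when it is not in the
  span of the coordinates selected from its tail.\<close>

lemma (in ring) spanning_coordinates:
  assumes "subfield K R" "set xs \<subseteq> carrier R"
  obtains I where "I \<subseteq> {..<length xs}" "independent K (nths xs I)" "set xs \<subseteq> Span K (nths xs I)"
proof -
  have "\<exists>I \<subseteq> {..<length xs}. independent K (nths xs I) \<and> set xs \<subseteq> Span K (nths xs I)"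
    using assms(2)
  proof (induction xs)
    case (Cons x xs)
    then obtain I where I: "I \<subseteq> {..<length xs}" "independent K (nths xs I)" "set xs \<subseteq> Span K (nths xs I)"
      by auto
    have car: "set (nths xs I) \<subseteq> carrier R" by (rule independent_in_carrier[OF I(2)])
    have x: "x \<in> carrier R" using Cons.prems by simp
    have I_Suc: "Suc ` I \<subseteq> {..<length (x # xs)}" "{j. Suc j \<in> Suc ` I} = I"
      using I(1) by auto
    show ?case
    proof (cases "x \<in> Span K (nths xs I)")
      case True
      with I I_Suc show ?thesis
        by (intro exI[of _ "Suc ` I"]) (auto simp: nths_Cons simp del: Span.simps)
    next
      case False
      have "nths (x # xs) (insert 0 (Suc ` I)) = x # nths xs I"
        using I_Suc(2) by (simp add: nths_Cons)
      moreover have "independent K (x # nths xs I)" using x False I(2) by (rule li_Cons)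
      moreover have "set (x # xs) \<subseteq> Span K (x # nths xs I)"
        using mono_Span[OF assms(1) car x] Span_base_incl[OF assms(1), of "x # nths xs I"] I(3) x car
        by (auto simp del: Span.simps)
      ultimately show ?thesis
        using I_Suc(1) by (intro exI[of _ "insert 0 (Suc ` I)"]) (simp del: Span.simps)
    qed
  qed auto
  with that show thesis by blast
qed

section \<open>Cardinality of spans\<close>

lemma (in ring) Span_eq_image_combine:
  assumes "subfield K R" "set Us \<subseteq> carrier R"
  shows "Span K Us = (\<lambda>Ks. combine Ks Us) ` {Ks. set Ks \<subseteq> K \<and> length Ks = length Us}"
  unfolding Span_eq_combine_set_length_version[OF assms] by auto

lemma (in ring) card_Span_le:
  assumes "subfield K R" "finite K" "set Us \<subseteq> carrier R"
  shows "finite (Span K Us)" "card (Span K Us) \<le> card K ^ length Us"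
proof -
  let ?S = "{Ks. set Ks \<subseteq> K \<and> length Ks = length Us}"
  have S: "finite ?S" "card ?S = card K ^ length Us"
    using finite_lists_length_eq[OF assms(2)] card_lists_length_eq[OF assms(2)] by auto
  have eq: "Span K Us = (\<lambda>Ks. combine Ks Us) ` ?S"
    by (rule Span_eq_image_combine[OF assms(1,3)])
  show "finite (Span K Us)" unfolding eq using S(1) by (rule finite_imageI)
  show "card (Span K Us) \<le> card K ^ length Us"
    unfolding eq using card_image_le[OF S(1)] S(2) by metis
qed

text \<open>Coefficients with respect to an independent list are unique, so \<open>combine\<close>
  is injective on coefficient lists of the right length.\<close>

lemma (in ring) card_Span_independent:
  assumes "subfield K R" "finite K" "independent K Us"
  shows "card (Span K Us) = card K ^ length Us"
proof -
  have car: "set Us \<subseteq> carrier R" by (rule independent_in_carrier[OF assms(3)])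
  have "inj_on (\<lambda>Ks. combine Ks Us) {Ks. set Ks \<subseteq> K \<and> length Ks = length Us}"
    using unique_decomposition[OF assms(1,3)] Span_eq_image_combine[OF assms(1) car]
    by (intro inj_onI) (metis (mono_tags, lifting) imageI mem_Collect_eq)
  then show ?thesis
    unfolding Span_eq_image_combine[OF assms(1) car]
    by (simp add: card_image card_lists_length_eq[OF assms(2)])
qed

section \<open>Finite field extensions\<close>

text \<open>The degree \<open>m\<close> enters through the cardinality of the extension;
  \<open>obtain_basis\<close> turns it into a dimension over \<open>K\<close>.\<close>

locale finite_extension = field R for R :: "('a, 'b) ring_scheme" (structure) +
  fixes K :: "'a set" and q m :: nat
  assumes K: "subfield K R" and card_K: "card K = q" and card_R: "card (carrier R) = q ^ m"
    and q: "q > 1"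
begin

lemma finite_K: "finite K"
  using card_K q by (intro card_ge_0_finite) simp

lemma finite_R: "finite (carrier R)"
  using card_R q by (intro card_ge_0_finite) simp

lemma finite_vectors: "finite (vectors R n)"
  unfolding vectors_eq_list_box using finite_R by (intro finite_list_box)

lemma vectors_nonempty: "vectors R n \<noteq> {}"
proof -
  have "replicate n \<zero> \<in> vectors R n" by (auto simp: vectors_def)
  then show ?thesis by blast
qed

lemma card_vectors: "card (vectors R n) = q ^ (m * n)"
  by (simp add: vectors_eq_list_box card_list_box card_R power_mult)

text \<open>Greedy selection from a list of all field elements leaves an independent spanning list;
  counting its span in two ways shows that its length is \<open>m\<close>.\<close>

lemma obtain_basis:
  obtains Es where "independent K Es" "length Es = m" "Span K Es = carrier R"
proof -
  obtain xs where xs: "set xs = carrier R"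
    using finite_list[OF finite_R] by blast
  obtain I where I: "independent K (nths xs I)" "carrier R \<subseteq> Span K (nths xs I)"
    by (rule spanning_coordinates[OF K equalityD1[OF xs]]) (unfold xs)
  have "Span K (nths xs I) \<subseteq> carrier R"
    using independent_in_carrier[OF I(1)] by (rule Span_subgroup_props(1)[OF K])
  with I(2) have Span: "Span K (nths xs I) = carrier R" by auto
  then have "q ^ length (nths xs I) = q ^ m"
    using card_Span_independent[OF K finite_K I(1)] card_K card_R by simp
  then have "length (nths xs I) = m" using q by simp
  with I(1) Span that show ?thesis by blast
qed

lemma dimension_carrier: "dimension m K (carrier R)"
  by (rule obtain_basis) (metis dimension_independent)

section \<open>Number of vectors of low rank\<close>

text \<open>
  A vector of rank at most \<open>\<rho>\<close> is determined by the position of \<open>\<rho>\<close> coordinates that span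
  all the others, by the values of these \<open>\<rho>\<close> coordinates, and by an element of
  their span for each remaining position.
\<close>

lemma card_low_rank_le:
  assumes "\<rho> \<le> n"
  shows "card {x \<in> vectors R n. rank_weight R K x \<le> \<rho>} \<le> 2 ^ n * (q ^ (m * \<rho>) * q ^ (\<rho> * (n - \<rho>)))"
proof -
  define \<I> where "\<I> = {I. I \<subseteq> {..<n} \<and> card I = \<rho>}"
  \<comment> \<open>Values on \<open>I\<close> are stored in a full-length vector that is zero
    elsewhere, so that positions need no renumbering and each choice of values is counted
    once.\<close>
  define Z where "Z I = list_box n (\<lambda>i. if i \<in> I then carrier R else {\<zero>})" for I
  define X where "X I z = list_box n (\<lambda>i. if i \<in> I then {z ! i} else Span K (nths z I))" for I and z :: "'a list"
  have fin_\<I>: "finite \<I>" unfolding \<I>_def by simp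
  have fin_Z: "finite (Z I)" for I
    unfolding Z_def using finite_R by (intro finite_list_box) simp
  have Z_car: "set (nths z I) \<subseteq> carrier R" if "z \<in> Z I" for z I
    using that by (auto simp: Z_def list_box_def set_nths)
  have "{x \<in> vectors R n. rank_weight R K x \<le> \<rho>} \<subseteq> (\<Union>I\<in>\<I>. \<Union>z\<in>Z I. X I z)"
  proof
    fix x assume "x \<in> {x \<in> vectors R n. rank_weight R K x \<le> \<rho>}"
    then have x: "set x \<subseteq> carrier R" "length x = n" and rk: "rank_weight R K x \<le> \<rho>"
      by (auto simp: vectors_def)
    obtain I where I: "I \<subseteq> {..<n}" "independent K (nths x I)" "set x \<subseteq> Span K (nths x I)"
      using spanning_coordinates[OF K x(1)] x(2) by metis
    have "card I \<le> \<rho>" using rank_weight_ge[of I x K] I rk x(2) by simp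
    \<comment> \<open>The spanning positions are padded to exactly \<rho> many, so that one count
      fits every vector. The added coordinates may be dependent, hence spans are only bounded above
      in size.\<close>
    then obtain I' where I': "I \<subseteq> I'" "I' \<subseteq> {..<n}" "card I' = \<rho>"
      using exists_subset_between[of I \<rho> "{..<n}"] I(1) assms by auto
    define z where "z = map (\<lambda>i. if i \<in> I' then x ! i else \<zero>) [0..<n]"
    have "nths z I' = nths x I'"
      by (rule nths_cong) (auto simp: z_def x(2))
    moreover have "Span K (nths x I) \<subseteq> Span K (nths x I')"
      using I'(1) x(1) by (intro mono_Span_sublist[OF K]) (auto simp: set_nths)
    ultimately have "set x \<subseteq> Span K (nths z I')" using I(3) by simp
    then have "x \<in> X I' z"
      using x(2) by (auto simp: X_def list_box_def z_def simp del: Span.simps)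
    moreover have "z \<in> Z I'"
      using x by (auto simp: z_def Z_def list_box_def)
    ultimately show "x \<in> (\<Union>I\<in>\<I>. \<Union>z\<in>Z I. X I z)"
      using I' by (auto simp: \<I>_def)
  qed
  moreover have fin_X: "finite (X I z)" if "z \<in> Z I" for I z
    unfolding X_def using card_Span_le(1)[OF K finite_K Z_car[OF that]]
    by (intro finite_list_box) (simp del: Span.simps)
  moreover have "finite (\<Union>I\<in>\<I>. \<Union>z\<in>Z I. X I z)"
    using fin_\<I> fin_Z fin_X by blast
  ultimately have "card {x \<in> vectors R n. rank_weight R K x \<le> \<rho>} \<le> card (\<Union>I\<in>\<I>. \<Union>z\<in>Z I. X I z)"
    by (intro card_mono)
  also have "\<dots> \<le> card \<I> * (q ^ (m * \<rho>) * q ^ (\<rho> * (n - \<rho>)))"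
  proof (rule card_UN_le_mult[OF fin_\<I>])
    fix I assume "I \<in> \<I>"
    then have I: "I \<subseteq> {..<n}" "card I = \<rho>" by (auto simp: \<I>_def)
    have "card (Z I) = q ^ (m * \<rho>)"
      using I by (simp add: Z_def card_list_box if_distrib[of card] prod_if_subset card_R power_mult)
    moreover have "card (X I z) \<le> q ^ (\<rho> * (n - \<rho>))" if z: "z \<in> Z I" for z
    proof -
      have "length (nths z I) = \<rho>"
        using z I by (simp add: Z_def list_box_def length_nths_subset)
      then have "card (Span K (nths z I)) \<le> q ^ \<rho>"
        using card_Span_le(2)[OF K finite_K Z_car[OF z]] card_K by simp
      then have "card (Span K (nths z I)) ^ (n - \<rho>) \<le> (q ^ \<rho>) ^ (n - \<rho>)"
        by (rule power_mono) simp
      moreover have "card (X I z) = (\<Prod>i<n. if i \<in> I then 1 else card (Span K (nths z I)))"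
        unfolding X_def card_list_box by (intro prod.cong) auto
      ultimately show ?thesis
        using I by (simp add: prod_if_subset power_mult del: Span.simps)
    qed
    ultimately show "card (\<Union>z\<in>Z I. X I z) \<le> q ^ (m * \<rho>) * q ^ (\<rho> * (n - \<rho>))"
      using card_UN_le_mult[OF fin_Z, of I "X I"] by metis
  qed
  also have "card \<I> \<le> card (Pow {..<n})"
    by (rule card_mono) (auto simp: \<I>_def)
  then have "card \<I> * (q ^ (m * \<rho>) * q ^ (\<rho> * (n - \<rho>))) \<le> 2 ^ n * (q ^ (m * \<rho>) * q ^ (\<rho> * (n - \<rho>)))"
    by (intro mult_right_mono) (simp_all add: card_Pow)
  finally show ?thesis .
qed

section \<open>The sphere covering bound\<close>

lemma vector_diff_closed:
  "x \<in> vectors R n \<Longrightarrow> c \<in> vectors R n \<Longrightarrow> vector_diff R x c \<in> vectors R n"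
  unfolding vectors_eq_list_box by (simp add: list_box_def nth_vector_diff)

lemma inj_on_vector_diff:
  assumes "c \<in> vectors R n"
  shows "inj_on (\<lambda>x. vector_diff R x c) (vectors R n)"
proof (rule inj_onI)
  fix x y
  assume xy: "x \<in> vectors R n" "y \<in> vectors R n" "vector_diff R x c = vector_diff R y c"
  then have len: "length x = n" "length y = n" "length c = n"
    using assms by (auto simp: vectors_def)
  show "x = y"
  proof (rule nth_equalityI)
    fix i assume "i < length x"
    then have i: "i < n" using len by simp
    then have car: "x ! i \<in> carrier R" "y ! i \<in> carrier R" "c ! i \<in> carrier R"
      using xy assms by (auto intro: vectors_nth)
    have "x ! i \<ominus> c ! i = y ! i \<ominus> c ! i"
      using xy(3) nth_vector_diff[of _ c i R] len i by metis
    then show "x ! i = y ! i" using car by (simp add: minus_eq)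
  qed (use len in simp)
qed

text \<open>The space and the code are finite and nonempty, so bounds on \<open>Max\<close> and
  \<open>Min\<close> become quantifiers.\<close>

lemma rank_covering_radius_le_iff:
  assumes "C \<subseteq> vectors R n" "C \<noteq> {}"
  shows "rank_covering_radius R K n C \<le> \<rho> \<longleftrightarrow> (\<forall>x\<in>vectors R n. \<exists>c\<in>C. rank_dist R K x c \<le> \<rho>)"
  using finite_subset[OF assms(1) finite_vectors] assms(2) finite_vectors[of n] vectors_nonempty[of n]
  unfolding rank_covering_radius_def by (simp add: Min_le_iff)

text \<open>Subtracting \<open>c\<close> maps the ball around \<open>c\<close> injectively into the
  vectors of rank at most \<rho>. Hence each ball obeys the bound of
  \<open>card_low_rank_le\<close>, and \<open>card C\<close> of them fill the space.\<close>

lemma covering_card_ge: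
  assumes "\<rho> \<le> n" "C \<subseteq> vectors R n" "C \<noteq> {}" "rank_covering_radius R K n C \<le> \<rho>"
  shows "q ^ (m * n) \<le> card C * (2 ^ n * (q ^ (m * \<rho>) * q ^ (\<rho> * (n - \<rho>))))"
proof -
  define B where "B c = {x \<in> vectors R n. rank_dist R K x c \<le> \<rho>}" for c
  have fin: "finite C" by (rule finite_subset[OF assms(2) finite_vectors])
  have "vectors R n \<subseteq> (\<Union>c\<in>C. B c)"
    using assms(4) rank_covering_radius_le_iff[OF assms(2,3)] by (auto simp: B_def)
  then have "card (vectors R n) \<le> card (\<Union>c\<in>C. B c)"
    using fin finite_vectors by (intro card_mono) (auto simp: B_def)
  also have "\<dots> \<le> card C * (2 ^ n * (q ^ (m * \<rho>) * q ^ (\<rho> * (n - \<rho>))))"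
  proof (rule card_UN_le_mult[OF fin])
    fix c assume "c \<in> C"
    then have c: "c \<in> vectors R n" using assms(2) by blast
    have "card (B c) \<le> card {x \<in> vectors R n. rank_weight R K x \<le> \<rho>}"
    proof (rule card_inj_on_le)
      show "inj_on (\<lambda>x. vector_diff R x c) (B c)"
        by (rule inj_on_subset[OF inj_on_vector_diff[OF c]]) (auto simp: B_def)
      show "(\<lambda>x. vector_diff R x c) ` B c \<subseteq> {x \<in> vectors R n. rank_weight R K x \<le> \<rho>}"
        using vector_diff_closed c by (auto simp: B_def rank_dist_def)
    qed (simp add: finite_vectors)
    also note card_low_rank_le[OF assms(1)]
    finally show "card (B c) \<le> 2 ^ n * (q ^ (m * \<rho>) * q ^ (\<rho> * (n - \<rho>)))" .
  qed
  finally show ?thesis by (simp add: card_vectors)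
qed

section \<open>A covering code from subspaces spanned by basis elements\<close>

text \<open>
  If \<open>\<rho>\<close> coordinates of \<open>x\<close> are independent and a subset of a fixed basis spans a complement of
  their span, then \<open>x\<close> has distance at most \<open>\<rho>\<close> from the vector of the components of its
  coordinates in that complement, which vanishes at the \<open>\<rho>\<close> chosen positions.
\<close>

lemma covering_code:
  assumes "\<rho> \<le> n"
  obtains C where "C \<subseteq> vectors R n" "C \<noteq> {}" "rank_covering_radius R K n C \<le> \<rho>"
    "card C \<le> 2 ^ n * (2 ^ m * q ^ ((m - \<rho>) * (n - \<rho>)))"
proof -
  obtain Es where Es: "independent K Es" "length Es = m" "Span K Es = carrier R"
    by (rule obtain_basis)
  have Es_car: "set Es \<subseteq> carrier R" by (rule independent_in_carrier[OF Es(1)])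
  have dist: "distinct Es" by (rule independent_distinct[OF K Es(1)])
  define \<I> where "\<I> = {I. I \<subseteq> {..<n} \<and> card I = \<rho>}"
  \<comment> \<open>The inequality puts the empty set into \<open>\<J>\<close> in all cases. If
    \<rho> exceeds \<open>m\<close>, then \<open>m - \<rho>\<close> is 0, only the empty set
    remains, and the code consists of the zero vector.\<close>
  define \<J> where "\<J> = {J. J \<subseteq> set Es \<and> card J \<le> m - \<rho>}"
  \<comment> \<open>\<open>Span\<close> takes a list; filtering \<open>Es\<close> fixes an order, so
    that the subspace depends on the set \<open>J\<close> alone.\<close>
  define W where "W J = Span K (filter (\<lambda>e. e \<in> J) Es)" for J
  define D where "D I J = list_box n (\<lambda>i. if i \<in> I then {\<zero>} else W J)" for I J
  define C where "C = (\<Union>I\<in>\<I>. \<Union>J\<in>\<J>. D I J)"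
  have fin_\<I>: "finite \<I>" and fin_\<J>: "finite \<J>" unfolding \<I>_def \<J>_def by auto
  have filter_car: "set (filter (\<lambda>e. e \<in> J) Es) \<subseteq> carrier R" for J
    using Es_car by auto
  have W_car: "W J \<subseteq> carrier R" and W_zero: "\<zero> \<in> W J" for J
    unfolding W_def using Span_subgroup_props(1,2)[OF K filter_car] by blast+
  have card_W: "card (W J) \<le> q ^ (m - \<rho>)" if "J \<in> \<J>" for J
  proof -
    have "length (filter (\<lambda>e. e \<in> J) Es) = card (set (filter (\<lambda>e. e \<in> J) Es))"
      using dist by (simp only: distinct_card distinct_filter)
    also have "set (filter (\<lambda>e. e \<in> J) Es) = J" using that by (auto simp: \<J>_def)
    finally have "length (filter (\<lambda>e. e \<in> J) Es) \<le> m - \<rho>" using that by (simp add: \<J>_def)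
    then have "q ^ length (filter (\<lambda>e. e \<in> J) Es) \<le> q ^ (m - \<rho>)"
      using q by (intro power_increasing) auto
    with card_Span_le(2)[OF K finite_K filter_car] show ?thesis
      unfolding W_def card_K by (rule order_trans)
  qed
  have C_sub: "C \<subseteq> vectors R n"
  proof
    fix c assume "c \<in> C"
    then obtain I J where "c \<in> D I J" by (auto simp: C_def)
    then show "c \<in> vectors R n"
      unfolding vectors_eq_list_box D_def list_box_def using W_car[of J] by (auto split: if_splits)
  qed
  \<comment> \<open>The zero vector makes the code nonempty and serves all vectors of rank below
    \<rho>, which do not have \<rho> independent coordinates.\<close>
  have zero_C: "replicate n \<zero> \<in> C"
  proof -
    obtain I where "I \<subseteq> {..<n}" "card I = \<rho>"
      using obtain_subset_with_card_n[of \<rho> "{..<n}"] assms by auto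
    then have "I \<in> \<I>" by (simp add: \<I>_def)
    moreover have "{} \<in> \<J>" by (simp add: \<J>_def)
    moreover have "replicate n \<zero> \<in> D I {}" by (simp add: D_def list_box_def W_zero)
    ultimately show ?thesis by (auto simp: C_def)
  qed
  have "card C \<le> card \<I> * (2 ^ m * q ^ ((m - \<rho>) * (n - \<rho>)))"
    unfolding C_def
  proof (rule card_UN_le_mult[OF fin_\<I>])
    fix I assume "I \<in> \<I>"
    then have I: "I \<subseteq> {..<n}" "card I = \<rho>" by (auto simp: \<I>_def)
    have "card (D I J) \<le> q ^ ((m - \<rho>) * (n - \<rho>))" if "J \<in> \<J>" for J
    proof -
      have "card (W J) ^ (n - \<rho>) \<le> (q ^ (m - \<rho>)) ^ (n - \<rho>)"
        by (rule power_mono[OF card_W[OF that]]) simp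
      then show ?thesis
        using I by (simp add: D_def card_list_box if_distrib[of card] prod_if_subset power_mult)
    qed
    then have "card (\<Union>J\<in>\<J>. D I J) \<le> card \<J> * q ^ ((m - \<rho>) * (n - \<rho>))"
      by (rule card_UN_le_mult[OF fin_\<J>])
    also have "card \<J> \<le> card (Pow (set Es))"
      by (rule card_mono) (auto simp: \<J>_def)
    then have "card \<J> * q ^ ((m - \<rho>) * (n - \<rho>)) \<le> 2 ^ m * q ^ ((m - \<rho>) * (n - \<rho>))"
      using dist Es(2) by (intro mult_right_mono) (simp_all add: card_Pow distinct_card)
    finally show "card (\<Union>J\<in>\<J>. D I J) \<le> 2 ^ m * q ^ ((m - \<rho>) * (n - \<rho>))" .
  qed
  also have "card \<I> \<le> card (Pow {..<n})"
    by (rule card_mono) (auto simp: \<I>_def)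
  then have "card \<I> * (2 ^ m * q ^ ((m - \<rho>) * (n - \<rho>))) \<le> 2 ^ n * (2 ^ m * q ^ ((m - \<rho>) * (n - \<rho>)))"
    by (intro mult_right_mono) (simp_all add: card_Pow)
  finally have card_C: "card C \<le> 2 ^ n * (2 ^ m * q ^ ((m - \<rho>) * (n - \<rho>)))" .
  have "\<exists>c\<in>C. rank_dist R K x c \<le> \<rho>" if x: "x \<in> vectors R n" for x
  proof (cases "rank_weight R K x < \<rho>")
    case True
    have "length x = n" using x by (simp add: vectors_def)
    then have "vector_diff R x (replicate n \<zero>) = x"
      by (intro nth_equalityI) (simp_all add: nth_vector_diff minus_eq vectors_nth[OF x])
    with True have "rank_dist R K x (replicate n \<zero>) \<le> \<rho>" by (simp add: rank_dist_def)
    with zero_C show ?thesis by blast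
  next
    case False
    have len: "length x = n" using x by (simp add: vectors_def)
    obtain I\<^sub>0 where I0: "I\<^sub>0 \<subseteq> {..<n}" "independent K (nths x I\<^sub>0)" "card I\<^sub>0 = rank_weight R K x"
      using rank_weight_attained len by metis
    \<comment> \<open>The rank may exceed \<rho>; exactly \<rho> of the independent positions are
      kept, since the code has a zero block for each set of that size.\<close>
    with False obtain I where I: "I \<subseteq> I\<^sub>0" "card I = \<rho>"
      using obtain_subset_with_card_n[of \<rho> I\<^sub>0] by (metis not_less)
    have I_n: "I \<subseteq> {..<n}" using I(1) I0(1) by blast
    have ind: "independent K (nths x I)" by (rule independent_nths_mono[OF K I0(2) I(1)])
    have car: "set (nths x I) \<subseteq> carrier R" by (rule independent_in_carrier[OF ind])
    have len_I: "length (nths x I) = \<rho>" using I_n I(2) len by (simp add: length_nths_subset)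
    obtain Us where Us: "length (Us @ nths x I) = m" "independent K (Us @ nths x I)"
      using complete_base[OF K dimension_carrier ind car] by blast
    have "Span K (Us @ nths x I) \<subseteq> Span K Es"
      unfolding Es(3) by (rule Span_subgroup_props(1)[OF K independent_in_carrier[OF Us(2)]])
    \<comment> \<open>The completion \<open>Us\<close> is arbitrary. Steinitz exchange replaces it
      by elements of the fixed basis, so that the complement is one of the finitely many spaces
      \<open>W J\<close>.\<close>
    then obtain Vs where Vs: "set Vs \<subseteq> set Es" "length Vs = length Us" "independent K (Vs @ nths x I)"
      using replacement_theorem[OF K Us(2) Es(1)] by blast
    have Vs_car: "set Vs \<subseteq> carrier R" using Vs(1) Es_car by blast
    have lens: "length Vs = m - \<rho>" "length (Vs @ nths x I) = m"
      using Us(1) Vs(2) len_I by auto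
    have J: "set Vs \<in> \<J>"
      using Vs(1) card_length[of Vs] lens(1) by (simp add: \<J>_def)
    have W_Vs: "W (set Vs) = Span K Vs"
      unfolding W_def using Vs(1) by (intro Span_same_set[OF K filter_car]) auto
    have "Span K (Vs @ nths x I) = carrier R"
      using independent_length_eq_dimension[OF K dimension_carrier Vs(3)] lens(2)
        independent_in_carrier[OF Vs(3)] by blast
    then have sum: "W (set Vs) <+>\<^bsub>R\<^esub> Span K (nths x I) = carrier R"
      unfolding W_Vs using Span_append_eq_set_add[OF K Vs_car car] by simp
    have "\<exists>w. w \<in> W (set Vs) \<and> x ! i \<ominus> w \<in> Span K (nths x I)" if "i < n" for i
    proof -
      have "x ! i \<in> W (set Vs) <+>\<^bsub>R\<^esub> Span K (nths x I)"
        unfolding sum by (rule vectors_nth[OF x that])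
      then obtain w s where ws: "w \<in> W (set Vs)" "s \<in> Span K (nths x I)" "x ! i = w \<oplus> s"
        unfolding set_add_def' by blast
      have "w \<in> carrier R" "s \<in> carrier R"
        using ws(1,2) W_car Span_subgroup_props(1)[OF K car] by blast+
      then have "x ! i \<ominus> w = s" unfolding ws(3) by algebra
      with ws show ?thesis by metis
    qed
    then obtain w where w: "\<And>i. i < n \<Longrightarrow> w i \<in> W (set Vs) \<and> x ! i \<ominus> w i \<in> Span K (nths x I)"
      by metis
    define c where "c = map (\<lambda>i. if i \<in> I then \<zero> else w i) [0..<n]"
    have "c \<in> D I (set Vs)"
      using w by (auto simp: D_def c_def list_box_def)
    moreover have "I \<in> \<I>" using I(2) I_n by (simp add: \<I>_def)
    ultimately have "c \<in> C" using J by (auto simp: C_def)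
    \<comment> \<open>On \<open>I\<close> the codeword vanishes and the difference is
      \<open>x ! i\<close>, itself a generator of the span; off \<open>I\<close> the choice of
      \<open>w\<close> applies.\<close>
    have "vector_diff R x c ! i \<in> Span K (nths x I)" if "i < n" for i
    proof (cases "i \<in> I")
      case True
      then have "x ! i \<in> set (nths x I)" using that len by (auto simp: set_nths)
      then have "x ! i \<in> Span K (nths x I)" using Span_base_incl[OF K car] by blast
      then show ?thesis
        using True that len vectors_nth[OF x that]
        by (simp add: nth_vector_diff c_def minus_eq del: Span.simps)
    next
      case False
      then show ?thesis
        using w[OF that] that len by (simp add: nth_vector_diff c_def del: Span.simps)
    qed
    then have "set (vector_diff R x c) \<subseteq> Span K (nths x I)"
      using len by (auto simp: in_set_conv_nth c_def simp del: Span.simps)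
    then have "rank_dist R K x c \<le> \<rho>"
      unfolding rank_dist_def using rank_weight_le_length[OF K ind] len_I by metis
    with \<open>c \<in> C\<close> show ?thesis by blast
  qed
  then have "rank_covering_radius R K n C \<le> \<rho>"
    using rank_covering_radius_le_iff[OF C_sub] zero_C by blast
  with C_sub zero_C card_C that show ?thesis by blast
qed

text \<open>The constructed code shows that some cardinality is admissible. Hence
  \<open>LEAST\<close> is attained: it lies below the size of that code, and a code attaining it
  obeys the sphere covering bound.\<close>

lemma min_rank_covering_bounds:
  assumes "\<rho> \<le> n"
  shows "min_rank_covering R K n \<rho> \<le> 2 ^ n * (2 ^ m * q ^ ((m - \<rho>) * (n - \<rho>)))"
    and "q ^ (m * n) \<le> min_rank_covering R K n \<rho> * (2 ^ n * (q ^ (m * \<rho>) * q ^ (\<rho> * (n - \<rho>))))"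
proof -
  let ?P = "\<lambda>k. \<exists>C. C \<subseteq> vectors R n \<and> C \<noteq> {} \<and> rank_covering_radius R K n C \<le> \<rho> \<and> card C = k"
  obtain C where C: "C \<subseteq> vectors R n" "C \<noteq> {}" "rank_covering_radius R K n C \<le> \<rho>"
    "card C \<le> 2 ^ n * (2 ^ m * q ^ ((m - \<rho>) * (n - \<rho>)))"
    using covering_code[OF assms] .
  then have P: "?P (card C)" by blast
  have "min_rank_covering R K n \<rho> \<le> card C"
    unfolding min_rank_covering_def by (rule Least_le[of ?P, OF P])
  with C(4) show "min_rank_covering R K n \<rho> \<le> 2 ^ n * (2 ^ m * q ^ ((m - \<rho>) * (n - \<rho>)))"
    by simp
  have "?P (min_rank_covering R K n \<rho>)"
    unfolding min_rank_covering_def by (rule LeastI[of ?P, OF P])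
  then obtain C' where C': "C' \<subseteq> vectors R n" "C' \<noteq> {}" "rank_covering_radius R K n C' \<le> \<rho>"
    "card C' = min_rank_covering R K n \<rho>" by blast
  show "q ^ (m * n) \<le> min_rank_covering R K n \<rho> * (2 ^ n * (q ^ (m * \<rho>) * q ^ (\<rho> * (n - \<rho>))))"
    using covering_card_ge[OF assms C'(1-3)] C'(4) by simp
qed

end

section \<open>Logarithms and limits\<close>

lemma tendsto_nat_floor_mult_over:
  fixes r :: real
  assumes "r \<ge> 0"
  shows "(\<lambda>n. real (nat \<lfloor>r * real n\<rfloor>) / real n) \<longlonglongrightarrow> r"
proof (rule real_tendsto_sandwich)
  show "\<forall>\<^sub>F n in sequentially. r - 1 / real n \<le> real (nat \<lfloor>r * real n\<rfloor>) / real n"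
    using eventually_gt_at_top[of 0]
  proof eventually_elim
    case (elim n)
    have "r * real n - 1 \<le> real (nat \<lfloor>r * real n\<rfloor>)" by linarith
    then have "(r * real n - 1) / real n \<le> real (nat \<lfloor>r * real n\<rfloor>) / real n"
      by (rule divide_right_mono) simp
    with elim show ?case by (simp add: diff_divide_distrib)
  qed
  show "\<forall>\<^sub>F n in sequentially. real (nat \<lfloor>r * real n\<rfloor>) / real n \<le> r"
    using eventually_gt_at_top[of 0]
  proof eventually_elim
    case (elim n)
    have "real (nat \<lfloor>r * real n\<rfloor>) \<le> r * real n" using assms by simp
    with elim show ?case by (simp add: field_simps)
  qed
  show "(\<lambda>n. r - 1 / real n) \<longlonglongrightarrow> r"
    using tendsto_diff[OF tendsto_const lim_1_over_n, of r] by simp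
qed simp

text \<open>After taking logarithms to base \<open>q\<close> and dividing by \<open>m * n\<close>,
  the factor \<open>2 ^ n\<close> leaves \<open>log q 2 / m\<close> and \<open>2 ^ m\<close> leaves
  \<open>log q 2 / n\<close>. The \<open>max\<close> comes from the truncated subtraction
  \<open>m - \<rho>\<close>, as \<rho> may exceed \<open>m\<close>.\<close>

lemma log_covering_bounds:
  fixes q m n \<rho> N :: nat
  assumes "q > 1" "m > 0" "n > 0" "\<rho> \<le> n"
    and upper: "N \<le> 2 ^ n * (2 ^ m * q ^ ((m - \<rho>) * (n - \<rho>)))"
    and lower: "q ^ (m * n) \<le> N * (2 ^ n * (q ^ (m * \<rho>) * q ^ (\<rho> * (n - \<rho>))))"
  shows "log (real (q ^ (m * n))) (real N)
      \<le> max 0 (1 - real \<rho> / real m) * (1 - real \<rho> / real n) + log q 2 * (1 / real m + 1 / real n)"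
    and "(1 - real \<rho> / real m) * (1 - real \<rho> / real n) - log q 2 * (1 / real m)
      \<le> log (real (q ^ (m * n))) (real N)"
proof -
  \<comment> \<open>Positivity comes from the lower bound, whose left side is positive; it makes the
    logarithm of \<open>N\<close> a genuine one.\<close>
  have N: "N > 0" using lower \<open>q > 1\<close> by (intro gr0I) simp
  have log_eq: "log (real (q ^ (m * n))) (real N) = log q N / (real m * real n)"
    using \<open>q > 1\<close> N by (simp add: log_def ln_realpow)
  have diff: "real (m - \<rho>) = max 0 (real m - real \<rho>)" "real (n - \<rho>) = real n - real \<rho>"
    using \<open>\<rho> \<le> n\<close> by auto
  have "log q N \<le> log q (real (2 ^ n * (2 ^ m * q ^ ((m - \<rho>) * (n - \<rho>)))))"
    using upper N \<open>q > 1\<close> by (subst log_le_cancel_iff) (auto simp del: of_nat_mult of_nat_power)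
  also have "\<dots> = real n * log q 2 + (real m * log q 2 + real (m - \<rho>) * real (n - \<rho>))"
    using \<open>q > 1\<close> by (simp add: log_mult log_nat_power)
  finally have "log q N / (real m * real n)
      \<le> (real n * log q 2 + (real m * log q 2 + real (m - \<rho>) * real (n - \<rho>))) / (real m * real n)"
    by (rule divide_right_mono) simp
  also have "\<dots> = real (m - \<rho>) / real m * (real (n - \<rho>) / real n) + log q 2 * (1 / real m + 1 / real n)"
    using \<open>m > 0\<close> \<open>n > 0\<close> by (simp add: field_simps)
  also have "real (m - \<rho>) / real m = max 0 (1 - real \<rho> / real m)"
    using \<open>m > 0\<close> by (auto simp: diff max_def field_simps)
  also have "real (n - \<rho>) / real n = 1 - real \<rho> / real n"
    using \<open>n > 0\<close> by (simp add: diff field_simps)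
  finally show "log (real (q ^ (m * n))) (real N)
      \<le> max 0 (1 - real \<rho> / real m) * (1 - real \<rho> / real n) + log q 2 * (1 / real m + 1 / real n)"
    by (simp only: log_eq)
  have "real m * real n = log q (real (q ^ (m * n)))"
    using \<open>q > 1\<close> by (simp add: log_nat_power)
  also have "\<dots> \<le> log q (real (N * (2 ^ n * (q ^ (m * \<rho>) * q ^ (\<rho> * (n - \<rho>))))))"
    using lower N \<open>q > 1\<close> by (subst log_le_cancel_iff) (auto simp del: of_nat_mult of_nat_power)
  also have "\<dots> = log q N + (real n * log q 2 + (real m * real \<rho> + real \<rho> * (real n - real \<rho>)))"
    using \<open>q > 1\<close> N by (simp add: log_mult log_nat_power diff)
  finally have "(real m * real n - (real n * log q 2 + (real m * real \<rho> + real \<rho> * (real n - real \<rho>)))) / (real m * real n)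
      \<le> log q N / (real m * real n)"
    by (intro divide_right_mono) auto
  \<comment> \<open>Over the reals, \<open>m * n - m * \<rho> - \<rho> * (n - \<rho>)\<close>
    factors as \<open>(m - \<rho>) * (n - \<rho>)\<close>, the exponent of the upper bound.\<close>
  also have "(real m * real n - (real n * log q 2 + (real m * real \<rho> + real \<rho> * (real n - real \<rho>)))) / (real m * real n)
      = (1 - real \<rho> / real m) * (1 - real \<rho> / real n) - log q 2 * (1 / real m)"
    using \<open>m > 0\<close> \<open>n > 0\<close> by (simp add: field_simps)
  finally show "(1 - real \<rho> / real m) * (1 - real \<rho> / real n) - log q 2 * (1 / real m)
      \<le> log (real (q ^ (m * n))) (real N)"
    by (simp only: log_eq)
qed

text \<open>The two bounds squeeze the whole sequence, so it converges and its limit is the liminf.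
  The fields form an arbitrary family of the given sizes, one extension for each
  \<open>n\<close>.\<close>

theorem theorem1:
  fixes q :: nat and b r :: real and m :: "nat \<Rightarrow> nat"
    and L :: "nat \<Rightarrow> ('a, 'b) ring_scheme" and F :: "nat \<Rightarrow> 'a set"
  assumes "primepow q"
    and "b > 0"
    and "0 \<le> r" and "r \<le> min 1 (inverse b)"
    and "\<And>n. m n > 0"
    and "(\<lambda>n. real n / real (m n)) \<longlonglongrightarrow> b"
    and "\<And>n. field (L n)" and "\<And>n. card (carrier (L n)) = q ^ m n"
    and "\<And>n. subfield (F n) (L n)" and "\<And>n. card (F n) = q"
  shows "liminf (\<lambda>n. ereal (log (real (q ^ (m n * n)))
             (real (min_rank_covering (L n) (F n) n (nat \<lfloor>r * real n\<rfloor>)))))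
         = ereal ((1 - r) * (1 - b * r))"
proof -
  define \<rho> where "\<rho> n = nat \<lfloor>r * real n\<rfloor>" for n
  define N where "N n = min_rank_covering (L n) (F n) n (\<rho> n)" for n
  define u where "u n = real (\<rho> n) / real (m n)" for n
  define v where "v n = real (\<rho> n) / real n" for n
  have q: "q > 1" using assms(1) by (rule primepow_gt_Suc_0[unfolded One_nat_def[symmetric]])
  have \<rho>_le: "\<rho> n \<le> n" for n
  proof -
    have "r * real n \<le> 1 * real n" using assms(4) by (intro mult_right_mono) auto
    then show ?thesis unfolding \<rho>_def by linarith
  qed
  have v: "v \<longlonglongrightarrow> r"
    unfolding v_def \<rho>_def using assms(3) by (rule tendsto_nat_floor_mult_over)
  \<comment> \<open>At \<open>n = 0\<close> the quotients by \<open>n\<close> and the logarithm to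
    base 1 are mere default values, so the estimates start at 1.\<close>
  have ev: "\<forall>\<^sub>F n :: nat in sequentially. n > 0" by (rule eventually_gt_at_top)
  have "(\<lambda>n. v n * (real n / real (m n))) \<longlonglongrightarrow> r * b"
    by (intro tendsto_mult v assms(6))
  then have u: "u \<longlonglongrightarrow> r * b"
    by (rule Lim_transform_eventually) (use ev in \<open>eventually_elim, simp add: u_def v_def\<close>)
  \<comment> \<open>Since \<open>n / m n\<close> has a finite limit, \<open>m n\<close> tends to
    infinity and the error term from \<open>2 ^ n\<close> vanishes.\<close>
  have "(\<lambda>n. 1 / real n * (real n / real (m n))) \<longlonglongrightarrow> 0 * b"
    by (intro tendsto_mult lim_1_over_n assms(6))
  then have m_lim: "(\<lambda>n. 1 / real (m n)) \<longlonglongrightarrow> 0"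
    unfolding mult_zero_left
    by (rule Lim_transform_eventually) (use ev in \<open>eventually_elim, simp\<close>)
  \<comment> \<open>This is where \<open>r \<le> inverse b\<close> enters: the limit of
    \<open>1 - u n\<close> is nonnegative, so \<open>max\<close> with 0 leaves it unchanged and both
    bounds have the same limit.\<close>
  have br: "0 \<le> 1 - r * b"
    using assms(2,4) by (simp add: field_simps)
  have bounds: "log (real (q ^ (m n * n))) (real (N n))
      \<le> max 0 (1 - u n) * (1 - v n) + log q 2 * (1 / real (m n) + 1 / real n)"
    "(1 - u n) * (1 - v n) - log q 2 * (1 / real (m n)) \<le> log (real (q ^ (m n * n))) (real (N n))"
    if "n > 0" for n
  proof -
    interpret finite_extension "L n" "F n" q "m n"
      using assms q by (simp add: finite_extension_def finite_extension_axioms_def)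
    note min_rank_covering_bounds[OF \<rho>_le, of n]
    from log_covering_bounds[OF q assms(5) that \<rho>_le this]
    show "log (real (q ^ (m n * n))) (real (N n))
      \<le> max 0 (1 - u n) * (1 - v n) + log q 2 * (1 / real (m n) + 1 / real n)"
      "(1 - u n) * (1 - v n) - log q 2 * (1 / real (m n)) \<le> log (real (q ^ (m n * n))) (real (N n))"
      unfolding N_def u_def v_def by auto
  qed
  have "(\<lambda>n. log (real (q ^ (m n * n))) (real (N n))) \<longlonglongrightarrow> (1 - r) * (1 - b * r)"
  proof (rule real_tendsto_sandwich)
    show "\<forall>\<^sub>F n in sequentially. (1 - u n) * (1 - v n) - log q 2 * (1 / real (m n))
        \<le> log (real (q ^ (m n * n))) (real (N n))"
      using ev by eventually_elim (rule bounds(2))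
    show "\<forall>\<^sub>F n in sequentially. log (real (q ^ (m n * n))) (real (N n))
        \<le> max 0 (1 - u n) * (1 - v n) + log q 2 * (1 / real (m n) + 1 / real n)"
      using ev by eventually_elim (rule bounds(1))
    have "(\<lambda>n. (1 - u n) * (1 - v n) - log q 2 * (1 / real (m n)))
        \<longlonglongrightarrow> (1 - r * b) * (1 - r) - log q 2 * 0"
      by (intro tendsto_intros u v m_lim)
    then show "(\<lambda>n. (1 - u n) * (1 - v n) - log q 2 * (1 / real (m n))) \<longlonglongrightarrow> (1 - r) * (1 - b * r)"
      by (simp add: mult.commute)
    have "(\<lambda>n. max 0 (1 - u n) * (1 - v n) + log q 2 * (1 / real (m n) + 1 / real n))
        \<longlonglongrightarrow> max 0 (1 - r * b) * (1 - r) + log q 2 * (0 + 0)"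
      by (intro tendsto_intros tendsto_max u v m_lim lim_1_over_n)
    then show "(\<lambda>n. max 0 (1 - u n) * (1 - v n) + log q 2 * (1 / real (m n) + 1 / real n))
        \<longlonglongrightarrow> (1 - r) * (1 - b * r)"
      using br by (simp add: max_def mult.commute split: if_splits)
  qed
  then have "(\<lambda>n. ereal (log (real (q ^ (m n * n))) (real (N n)))) \<longlonglongrightarrow> ereal ((1 - r) * (1 - b * r))"
    by (rule tendsto_ereal)
  then show ?thesis
    unfolding N_def \<rho>_def by (intro lim_imp_Liminf) simp_all
qed

end
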